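(* Let $k\geq 4$ and let $\mathcal{C}_k$ denote the family of all non-monochromatic bicolored cycles of length $k$. Then $\mathrm{ex}(\tfrac12,\mathcal{C}_k)=\tfrac12$.
   Context: A bicolored graph is a simple graph whose edges are each colored red or blue; it is non-monochromatic if both colors occur. A bicolored graph $G$ is $\varepsilon$-balanced if each color class contains at least $\varepsilon\cdot e(G)$ edges. $G$ contains $F$ if there is an injective map $V(F)\to V(G)$ sending every edge of $F$ to an edge of $G$ of the same color. For a family $\mathcal{F}$ of bicolored graphs, $\mathrm{ex}(\varepsilon,n,\mathcal{F})$ is the maximum number of edges of an $n$-vertex $\varepsilon$-balanced bicolored graph containing no member of $\mathcal{F}$, and $\mathrm{ex}(\varepsilon,\mathcal{F}):=\lim_{n\to\infty}\mathrm{ex}(\varepsilon,n,\mathcal{F})/\binom{n}{2}$. *)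

theory Defs
  imports Complex_Main
begin

datatype colour = Red | Blue

text \<open>The values of \<open>colour_of\<close> outside the edge set carry no information.\<close>

record 'a bgraph =
  verts :: "'a set"
  edges :: "'a set set"
  colour_of :: "'a set \<Rightarrow> colour"

definition bicolored_graph :: "'a bgraph \<Rightarrow> bool" where
  "bicolored_graph G \<longleftrightarrow>
     finite (verts G) \<and> (\<forall>e\<in>edges G. e \<subseteq> verts G \<and> card e = 2)"

definition colour_class :: "'a bgraph \<Rightarrow> colour \<Rightarrow> 'a set set" where
  "colour_class G c = {e \<in> edges G. colour_of G e = c}"

definition non_monochromatic :: "'a bgraph \<Rightarrow> bool" where
  "non_monochromatic G \<longleftrightarrow> (\<forall>c. colour_class G c \<noteq> {})"

definition balanced :: "real \<Rightarrow> 'a bgraph \<Rightarrow> bool" where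
  "balanced \<epsilon> G \<longleftrightarrow>
     (\<forall>c. real (card (colour_class G c)) \<ge> \<epsilon> * real (card (edges G)))"

definition contains :: "'a bgraph \<Rightarrow> 'b bgraph \<Rightarrow> bool" where
  "contains G F \<longleftrightarrow>
     (\<exists>f. inj_on f (verts F) \<and> f ` verts F \<subseteq> verts G \<and>
          (\<forall>e\<in>edges F. f ` e \<in> edges G \<and> colour_of G (f ` e) = colour_of F e))"

text \<open>Every finite graph has an isomorphic copy with vertices in \<^typ>\<open>nat\<close>, so host graphs
  and families are taken over this type. The set below is always finite; it is empty
  only in degenerate cases (such as a family with an edgeless member on at most \<open>n\<close> vertices),
  where the maximum is unspecified: for \<open>n\<close> vertices and \<open>\<F>\<close> without edgeless members,
  the edgeless graph is a candidate.\<close>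

definition ex_number :: "real \<Rightarrow> nat \<Rightarrow> nat bgraph set \<Rightarrow> nat" where
  "ex_number \<epsilon> n \<F> =
     Max {card (edges G) | G :: nat bgraph.
            bicolored_graph G \<and> card (verts G) = n \<and> balanced \<epsilon> G \<and>
            (\<forall>F\<in>\<F>. \<not> contains G F)}"

definition ex_ratio :: "real \<Rightarrow> nat bgraph set \<Rightarrow> nat \<Rightarrow> real" where
  "ex_ratio \<epsilon> \<F> n = real (ex_number \<epsilon> n \<F>) / real (n choose 2)"

text \<open>Meaningful only together with convergence of the sequence.\<close>

definition ex_density :: "real \<Rightarrow> nat bgraph set \<Rightarrow> real" where
  "ex_density \<epsilon> \<F> = lim (ex_ratio \<epsilon> \<F>)"

text \<open>For \<open>k \<ge> 3\<close> this says that the underlying graph is a cycle with \<open>k\<close> vertices.\<close>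

definition is_cycle :: "nat \<Rightarrow> 'a bgraph \<Rightarrow> bool" where
  "is_cycle k G \<longleftrightarrow>
     (\<exists>v. bij_betw v {..<k} (verts G) \<and>
          edges G = {{v i, v (Suc i mod k)} | i. i < k})"

definition non_mono_cycles :: "nat \<Rightarrow> nat bgraph set" where
  "non_mono_cycles k = {F. bicolored_graph F \<and> is_cycle k F \<and> non_monochromatic F}"

lemma finite_ex_candidates:
  "finite {card (edges G) | G :: nat bgraph.
             bicolored_graph G \<and> card (verts G) = n \<and> balanced \<epsilon> G \<and>
             (\<forall>F\<in>\<F>. \<not> contains G F)}"
proof (rule finite_subset)
  show "{card (edges G) | G :: nat bgraph.
             bicolored_graph G \<and> card (verts G) = n \<and> balanced \<epsilon> G \<and>
             (\<forall>F\<in>\<F>. \<not> contains G F)} \<subseteq> {..2 ^ n}"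
  proof clarsimp
    fix G :: "nat bgraph"
    assume G: "bicolored_graph G"
    then have "edges G \<subseteq> Pow (verts G)" "finite (verts G)"
      by (auto simp: bicolored_graph_def)
    then show "card (edges G) \<le> 2 ^ card (verts G)"
      by (metis card_Pow card_mono finite_Pow_iff)
  qed
qed simp

end

(* Two disjoint cliques of equal size, one red and one blue, give the lower bound.

   For the upper bound let G have n vertices and no non-monochromatic k-cycle. By pigeonhole, if
   linearly many vertices v had linearly many neighbours in both colours (k even), or quadratically
   many edges yz of one colour in their neighbourhood and linearly many neighbours w in the other
   colour (k odd), then many v would share the neighbours w_1, w_2, ... and the vertex or edge
   closing up a forbidden cycle v_1 w_1 v_2 w_2 ... v_t. So up to few vertices, V splits into R (few
   blue edges at each vertex), B (few red edges) and U (few triangles at each vertex; only needed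
   for odd k). After deleting o(n^2) edges there is no R-B edge, and adjacent vertices one of which
   is in U have few common neighbours. If |B| > n/2, all red edges lie in R \<union> U, so there are at
   most n^2/8 of them, and balance bounds all edges by n^2/4; likewise for R. If |R| and |B| are at
   most n/2, the bound n^2/4 holds without regard to colours: removing an adjacent pair with few common
   neighbours costs about n edges, and n^2/4 drops by n - 1 when two vertices are removed. *)

theory Submission
  imports Defs "HOL-Real_Asymp.Real_Asymp"
begin

section \<open>Graphs whose edges at one vertex class lie in few triangles\<close>

definition nbrs :: "'a set set \<Rightarrow> 'a \<Rightarrow> 'a set" where
  "nbrs E x = {y. {x, y} \<in> E}"

definition simple_on :: "'a set \<Rightarrow> 'a set set \<Rightarrow> bool" where
  "simple_on V E \<longleftrightarrow> finite V \<and> (\<forall>e\<in>E. e \<subseteq> V \<and> card e = 2)"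

definition avoiding :: "'a set set \<Rightarrow> 'a set \<Rightarrow> 'a set set" where
  "avoiding E X = {e \<in> E. e \<inter> X = {}}"

lemma nbrs_mono: "E' \<subseteq> E \<Longrightarrow> nbrs E' x \<subseteq> nbrs E x"
  by (auto simp: nbrs_def)

lemma simple_on_mono: "simple_on V E \<Longrightarrow> E' \<subseteq> E \<Longrightarrow> simple_on V E'"
  by (auto simp: simple_on_def)

lemma simple_on_finite: "simple_on V E \<Longrightarrow> finite E"
  by (rule finite_subset[of _ "Pow V"]) (auto simp: simple_on_def)

lemma nbrs_subset: "simple_on V E \<Longrightarrow> nbrs E x \<subseteq> V"
  by (auto simp: simple_on_def nbrs_def)

lemma finite_nbrs: "simple_on V E \<Longrightarrow> finite (nbrs E x)"
  using nbrs_subset[of V E x] finite_subset by (auto simp: simple_on_def)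

lemma nbrs_irrefl: "simple_on V E \<Longrightarrow> {x, y} \<in> E \<Longrightarrow> x \<noteq> y"
  by (auto simp: simple_on_def)

lemma simple_on_edgeE:
  assumes "simple_on V E" "e \<in> E" "x \<in> e"
  obtains y where "e = {x, y}" "x \<noteq> y" "x \<in> V" "y \<in> V"
proof -
  have e: "card e = 2" "e \<subseteq> V" using assms by (auto simp: simple_on_def)
  then obtain a b where "e = {a, b}" "a \<noteq> b" by (auto simp: card_2_iff)
  with assms(3) e(2) that show ?thesis by (metis doubleton_eq_iff insertE insert_subset singletonD)
qed

lemma avoiding_subset: "avoiding E X \<subseteq> E"
  by (auto simp: avoiding_def)

lemma simple_on_avoiding: "simple_on V E \<Longrightarrow> simple_on (V - X) (avoiding E X)"
  by (auto simp: simple_on_def avoiding_def)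

lemma card_edges_at:
  assumes "simple_on V E"
  shows "card {e \<in> E. x \<in> e} \<le> card (nbrs E x)"
proof -
  have "{e \<in> E. x \<in> e} \<subseteq> (\<lambda>y. {x, y}) ` nbrs E x"
    using assms by (auto elim!: simple_on_edgeE simp: nbrs_def)
  then have "card {e \<in> E. x \<in> e} \<le> card ((\<lambda>y. {x, y}) ` nbrs E x)"
    using finite_nbrs[OF assms] by (intro card_mono) auto
  also have "\<dots> \<le> card (nbrs E x)" using finite_nbrs[OF assms] by (rule card_image_le)
  finally show ?thesis .
qed

lemma two_card_edges_le:
  assumes "simple_on V E"
  shows "2 * card E \<le> card V * card V"
proof -
  have "card E \<le> card {e. e \<subseteq> V \<and> card e = 2}"
    using assms by (intro card_mono) (auto simp: simple_on_def)
  also have "\<dots> = card V choose 2" using assms by (intro n_subsets) (auto simp: simple_on_def)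
  also have "\<dots> = card V * (card V - 1) div 2" by (rule choose_two)
  finally have "2 * card E \<le> card V * (card V - 1)" by linarith
  also have "\<dots> \<le> card V * card V" by simp
  finally show ?thesis .
qed

text \<open>Inclusion-exclusion: the degrees of \<open>x\<close> and \<open>y\<close> add up to the
  size of the union of their neighbourhoods, at most \<open>card V\<close>, plus that of the
  intersection. Counting the edge \<open>{x, y}\<close> twice is harmless.\<close>

lemma card_le_remove_pair:
  assumes E: "simple_on V E" and C: "card (nbrs E x \<inter> nbrs E y) \<le> C"
  shows "card E \<le> card (avoiding E {x, y}) + card V + C"
proof -
  have "E = avoiding E {x, y} \<union> {e \<in> E. x \<in> e} \<union> {e \<in> E. y \<in> e}"
    by (auto simp: avoiding_def)
  then have "card E \<le> card (avoiding E {x, y}) + card {e \<in> E. x \<in> e} + card {e \<in> E. y \<in> e}"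
    by (metis (no_types, lifting) card_Un_le le_trans add_le_mono1)
  also have "\<dots> \<le> card (avoiding E {x, y}) + (card (nbrs E x) + card (nbrs E y))"
    using card_edges_at[OF E] by (simp add: add_mono)
  also have "card (nbrs E x) + card (nbrs E y) = card (nbrs E x \<union> nbrs E y) + card (nbrs E x \<inter> nbrs E y)"
    using finite_nbrs[OF E] by (intro card_Un_Int) auto
  also have "card (nbrs E x \<union> nbrs E y) \<le> card V"
    using nbrs_subset[OF E] E by (intro card_mono) (auto simp: simple_on_def)
  finally show ?thesis using C by simp
qed

section \<open>Edge bounds of Mantel type under small codegrees\<close>

definition low_codegree :: "nat \<Rightarrow> 'a set \<Rightarrow> 'a set set \<Rightarrow> bool" where
  "low_codegree C U E \<longleftrightarrow>
     (\<forall>x\<in>U. \<forall>y. {x, y} \<in> E \<longrightarrow> card (nbrs E x \<inter> nbrs E y) \<le> C)"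

lemma low_codegree_mono:
  assumes "low_codegree C U E" "simple_on V E" "E' \<subseteq> E" "U' \<subseteq> U"
  shows "low_codegree C U' E'"
  unfolding low_codegree_def
proof (intro ballI allI impI)
  fix x y assume "x \<in> U'" "{x, y} \<in> E'"
  have "card (nbrs E' x \<inter> nbrs E' y) \<le> card (nbrs E x \<inter> nbrs E y)"
    using nbrs_mono[OF assms(3)] finite_nbrs[OF assms(2)] by (intro card_mono) auto
  also have "\<dots> \<le> C"
    using assms \<open>x \<in> U'\<close> \<open>{x, y} \<in> E'\<close> by (auto simp: low_codegree_def)
  finally show "card (nbrs E' x \<inter> nbrs E' y) \<le> C" .
qed

text \<open>One step of the inductions below. All bounds are on \<open>4 * card E\<close>, so that
  the main term is the square of the number of vertices, without fractions.\<close>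

lemma remove_edge_step:
  assumes E: "simple_on V E" and U: "low_codegree C U E" and x: "x \<in> U" "{x, y} \<in> E"
  shows "4 * card E \<le> 4 * card (avoiding E {x, y}) + 4 * card V + 4 * C"
    and "card V = card (V - {x, y}) + 2"
    and "low_codegree C (U - {x, y}) (avoiding E {x, y})"
    and "simple_on (V - {x, y}) (avoiding E {x, y})"
proof -
  have "card (nbrs E x \<inter> nbrs E y) \<le> C" using U x by (auto simp: low_codegree_def)
  from card_le_remove_pair[OF E this]
  show "4 * card E \<le> 4 * card (avoiding E {x, y}) + 4 * card V + 4 * C" by simp
  have "x \<noteq> y" "{x, y} \<subseteq> V" "finite V" using E x nbrs_irrefl[OF E] by (auto simp: simple_on_def)
  then show "card V = card (V - {x, y}) + 2"
    using card_mono[of V "{x, y}"] by (simp add: card_Diff_subset)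
  show "low_codegree C (U - {x, y}) (avoiding E {x, y})"
    using low_codegree_mono[OF U E avoiding_subset] by auto
  show "simple_on (V - {x, y}) (avoiding E {x, y})" using simple_on_avoiding[OF E] .
qed

text \<open>Mantel's induction by removing adjacent pairs. When the vertex count drops from
  \<open>m\<close> to \<open>m - 2\<close>, the bound \<open>m\<^sup>2 + 2 * (C + 1) * m\<close>
  drops by exactly \<open>4 * m + 4 * C\<close>, the cost of one step.\<close>

lemma mantel_low_codegree:
  assumes "simple_on U E" "low_codegree C U E"
  shows "4 * card E \<le> (card U)\<^sup>2 + 2 * (C + 1) * card U"
  using assms
proof (induction "card U" arbitrary: U E rule: less_induct)
  case less
  show ?case
  proof (cases "E = {}")
    case False
    then obtain e where "e \<in> E" by auto
    moreover from this have "e \<noteq> {}" using less.prems by (auto simp: simple_on_def)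
    ultimately obtain x y where e: "{x, y} \<in> E" "x \<in> U"
      using simple_on_edgeE[OF less.prems(1)] by (metis ex_in_conv)
    note st = remove_edge_step[OF less.prems e(2,1)]
    have "4 * card (avoiding E {x, y}) \<le> (card (U - {x, y}))\<^sup>2 + 2 * (C + 1) * card (U - {x, y})"
      using st(2) by (intro less.hyps st) auto
    with st(1) show ?thesis unfolding st(2)
      by (simp add: power2_eq_square algebra_simps)
  qed simp
qed

text \<open>Edges inside \<open>R\<close> are unrestricted, so a clique there must be paid for by
  the term with \<open>max\<close>. Removing an adjacent pair across \<open>R\<close> and
  \<open>U\<close> keeps \<open>card R - card U\<close>, hence that term, fixed; once no crossing
  edge is left, \<open>R\<close> and \<open>U\<close> are bounded separately. Integers avoid
  truncated subtraction.\<close>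

lemma two_class_bound:
  assumes "simple_on (R \<union> U) E" "low_codegree C U E" "R \<inter> U = {}"
  shows "4 * int (card E) \<le> (int (card R) + int (card U))\<^sup>2 + (max 0 (int (card R) - int (card U)))\<^sup>2
     + 2 * (int C + 1) * (int (card R) + int (card U))"
  using assms
proof (induction "card U" arbitrary: R U E rule: less_induct)
  case less
  have fin: "finite R" "finite U" using less.prems by (auto simp: simple_on_def)
  show ?case
  proof (cases "\<exists>x\<in>U. \<exists>y\<in>R. {x, y} \<in> E")
    case True
    then obtain x y where e: "x \<in> U" "y \<in> R" "{x, y} \<in> E" by auto
    note st = remove_edge_step[OF less.prems(1,2) e(1,3)]
    have sets: "R \<union> U - {x, y} = (R - {y}) \<union> (U - {x})" "U - {x, y} = U - {x}"
      using e less.prems(3) by auto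
    have c: "card R = Suc (card (R - {y}))" "card U = Suc (card (U - {x}))"
      using e fin by (metis card.remove)+
    have cV: "card (R \<union> U) = card R + card U" using fin less.prems(3) by (rule card_Un_disjoint)
    have "4 * int (card (avoiding E {x, y})) \<le> (int (card (R - {y})) + int (card (U - {x})))\<^sup>2
      + (max 0 (int (card (R - {y})) - int (card (U - {x}))))\<^sup>2
      + 2 * (int C + 1) * (int (card (R - {y})) + int (card (U - {x})))"
      using c st(3,4) less.prems(3) unfolding sets by (intro less.hyps) auto
    moreover have "4 * int (card E) \<le> 4 * int (card (avoiding E {x, y})) + 4 * int (card (R \<union> U)) + 4 * int C"
      using st(1) by linarith
    ultimately show ?thesis unfolding cV unfolding c
      by (simp add: power2_eq_square algebra_simps)
  next
    case False
    have "E = {e \<in> E. e \<subseteq> R} \<union> {e \<in> E. e \<subseteq> U}"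
    proof (intro equalityI subsetI)
      fix e assume "e \<in> E"
      moreover from this obtain x y where "e = {x, y}" "x \<in> R \<union> U" "y \<in> R \<union> U"
        using less.prems(1) by (auto simp: simple_on_def card_2_iff)
      ultimately show "e \<in> {e \<in> E. e \<subseteq> R} \<union> {e \<in> E. e \<subseteq> U}"
        using False by (auto simp: insert_commute)
    qed auto
    then have "card E \<le> card {e \<in> E. e \<subseteq> R} + card {e \<in> E. e \<subseteq> U}"
      by (metis card_Un_le)
    moreover have "2 * card {e \<in> E. e \<subseteq> R} \<le> card R * card R"
      using less.prems fin by (intro two_card_edges_le) (auto simp: simple_on_def)
    moreover have "4 * card {e \<in> E. e \<subseteq> U} \<le> (card U)\<^sup>2 + 2 * (C + 1) * card U"
      using less.prems fin
      by (intro mantel_low_codegree low_codegree_mono[OF less.prems(2,1)]) (auto simp: simple_on_def)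
    ultimately have "4 * card E \<le> 2 * (card R * card R) + (card U)\<^sup>2 + 2 * (C + 1) * card U"
      by linarith
    then have "4 * int (card E) \<le> 2 * (int (card R) * int (card R)) + (int (card U))\<^sup>2 + 2 * (int C + 1) * int (card U)"
      by (metis (mono_tags) of_nat_mono of_nat_add of_nat_mult of_nat_power of_nat_numeral of_nat_1)
    also have "\<dots> \<le> (int (card R) + int (card U))\<^sup>2 + (max 0 (int (card R) - int (card U)))\<^sup>2
      + 2 * (int C + 1) * (int (card R) + int (card U))"
    proof -
      define r u c where "r = int (card R)" and "u = int (card U)" and "c = int C"
      have nn: "0 \<le> r" "0 \<le> u" "0 \<le> c" by (auto simp: r_def u_def c_def)
      \<comment> \<open>For \<open>r \<le> u\<close> the surplus \<open>r * r\<close> is covered by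
        the cross term \<open>2 * r * u\<close>; otherwise the right-hand side equals
        \<open>2 * r * r + 2 * u * u\<close>.\<close>
      have "2 * (r * r) + u\<^sup>2 \<le> (r + u)\<^sup>2 + (max 0 (r - u))\<^sup>2"
      proof (cases "r \<le> u")
        case True
        then have "r * r \<le> r * (2 * u)" using nn by (intro mult_left_mono) auto
        with True nn show ?thesis by (simp add: power2_eq_square algebra_simps max_def)
      next
        case False
        with nn show ?thesis by (simp add: power2_eq_square algebra_simps max_def)
      qed
      moreover have "2 * (c + 1) * u \<le> 2 * (c + 1) * (r + u)" using nn by (intro mult_left_mono) auto
      ultimately show ?thesis unfolding r_def u_def c_def by linarith
    qed
    finally show ?thesis .
  qed
qed

text \<open>Packages the removal of an edge between \<open>U\<close> and one of the other classes,
  with the third class untouched; it is applied with either colour class in the role of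
  \<open>B\<close>.\<close>

lemma two_class_step:
  assumes "simple_on V E" "low_codegree C U E" "x \<in> U" "y \<in> B" "{x, y} \<in> E"
    and "V = R \<union> B \<union> U" "R \<inter> B = {}" "R \<inter> U = {}" "B \<inter> U = {}"
  obtains U' B' E' where "simple_on (R \<union> B' \<union> U') E'" "low_codegree C U' E'"
    "U' \<subseteq> U" "B' \<subseteq> B" "E' \<subseteq> E"
    "card U = Suc (card U')" "card B = Suc (card B')"
    "4 * card E \<le> 4 * card E' + 4 * card (R \<union> B \<union> U) + 4 * C"
proof -
  have fin: "finite B" "finite U" using assms by (auto simp: simple_on_def)
  note st = remove_edge_step[OF assms(1,2,3,5)]
  have sets: "V - {x, y} = R \<union> (B - {y}) \<union> (U - {x})" "U - {x, y} = U - {x}"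
    using assms by auto
  show ?thesis
    using that[of "B - {y}" "U - {x}" "avoiding E {x, y}"] st assms avoiding_subset[of E "{x, y}"]
    unfolding sets by (metis Diff_subset card.remove fin)
qed

text \<open>End of the three-class induction: \<open>B\<close> is bounded as if it were a clique,
  \<open>R \<union> U\<close> by \<open>two_class_bound\<close>. The size conditions say that
  neither \<open>R\<close> nor \<open>B\<close> has more than \<open>(n + 1) / 2\<close> vertices;
  this rounding accounts for \<open>C + 2\<close> in place of \<open>C + 1\<close>.\<close>

lemma detached_class_bound:
  assumes E: "simple_on (R \<union> B \<union> U) E" "low_codegree C U E"
    and disj: "R \<inter> B = {}" "R \<inter> U = {}" "B \<inter> U = {}"
    and no: "\<And>x y. x \<in> B \<Longrightarrow> y \<in> R \<union> U \<Longrightarrow> {x, y} \<notin> E"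
    and le: "card R \<le> card B + card U + 1" "card B \<le> card R + card U + 1"
  defines "n \<equiv> card R + card B + card U"
  shows "4 * card E \<le> n\<^sup>2 + 2 * (C + 2) * n"
proof -
  have fin: "finite B" "finite U" "finite R" using E by (auto simp: simple_on_def)
  have "E = {e \<in> E. e \<subseteq> B} \<union> {e \<in> E. e \<subseteq> R \<union> U}"
  proof (intro equalityI subsetI)
    fix e assume "e \<in> E"
    moreover from this obtain x y where "e = {x, y}" "x \<in> R \<union> B \<union> U" "y \<in> R \<union> B \<union> U"
      using E by (auto simp: simple_on_def card_2_iff)
    ultimately show "e \<in> {e \<in> E. e \<subseteq> B} \<union> {e \<in> E. e \<subseteq> R \<union> U}"
      using no[of x y] no[of y x] by (auto simp: insert_commute)
  qed auto
  then have "card E \<le> card {e \<in> E. e \<subseteq> B} + card {e \<in> E. e \<subseteq> R \<union> U}"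
    by (metis card_Un_le)
  moreover have "2 * card {e \<in> E. e \<subseteq> B} \<le> card B * card B"
    using E fin by (intro two_card_edges_le) (auto simp: simple_on_def)
  ultimately have 1: "4 * int (card E) \<le> 2 * (int (card B) * int (card B)) + 4 * int (card {e \<in> E. e \<subseteq> R \<union> U})"
    by (simp flip: of_nat_mult)
  have 2: "4 * int (card {e \<in> E. e \<subseteq> R \<union> U}) \<le> (int (card R) + int (card U))\<^sup>2
      + (max 0 (int (card R) - int (card U)))\<^sup>2 + 2 * (int C + 1) * (int (card R) + int (card U))"
    using E fin disj
    by (intro two_class_bound low_codegree_mono[OF E(2,1)]) (auto simp: simple_on_def)
  define r b u c where "r = int (card R)" and "b = int (card B)" and "u = int (card U)" and "c = int C"
  have nn: "0 \<le> r" "0 \<le> b" "0 \<le> u" "0 \<le> c" by (auto simp: r_def b_def u_def c_def)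
  have le': "2 * r \<le> r + b + u + 1" "2 * b \<le> r + b + u + 1"
    using le unfolding r_def b_def u_def by linarith+
  \<comment> \<open>If \<open>u \<le> r\<close>, the left-hand side is twice the sum of the squares
    of \<open>b\<close>, \<open>r\<close>, \<open>u\<close>, each of which is at most half of
    \<open>r + b + u + 1\<close>. Otherwise \<open>b \<le> r + u + 1\<close>, and the second
    \<open>b * b\<close> is absorbed by the cross term \<open>2 * b * (r + u)\<close>.\<close>
  have "2 * (b * b) + (r + u)\<^sup>2 + (max 0 (r - u))\<^sup>2 \<le> (r + b + u)\<^sup>2 + 2 * (r + b + u)"
  proof (cases "u \<le> r")
    case True
    have "2 * b * b \<le> (r + b + u + 1) * b" "2 * r * r \<le> (r + b + u + 1) * r" "2 * u * u \<le> (r + b + u + 1) * u"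
      using nn le' True by (intro mult_right_mono; linarith)+
    with True nn show ?thesis by (simp add: power2_eq_square algebra_simps max_def)
  next
    case False
    define p where "p = b * r + b * u"
    have "b * b \<le> b * (r + u + 1)" using nn le' by (intro mult_left_mono) auto
    then have "b * b \<le> p + b" by (simp add: p_def algebra_simps)
    moreover have "0 \<le> p" using nn by (simp add: p_def)
    moreover have "(r + b + u)\<^sup>2 = (r + u)\<^sup>2 + 2 * p + b * b" unfolding p_def by algebra
    moreover have "(max 0 (r - u))\<^sup>2 = 0" using False by auto
    \<comment> \<open>Naming the nonlinear terms by variables leaves linear arithmetic.\<close>
    moreover have "2 * x + s + m \<le> T + 2 * (r + b + u)"
      if "x \<le> p + b" "0 \<le> p" "T = s + 2 * p + x" "m = 0" for x s m T :: int
      using that nn by presburger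
    ultimately show ?thesis by blast
  qed
  moreover have "2 * (c + 1) * (r + u) \<le> 2 * (c + 1) * (r + b + u)" using nn by (intro mult_left_mono) auto
  moreover have "2 * (c + 2) * (r + b + u) = 2 * (c + 1) * (r + b + u) + 2 * (r + b + u)" by algebra
  ultimately have "4 * int (card E) \<le> (r + b + u)\<^sup>2 + 2 * (c + 2) * (r + b + u)"
    using 1 2 unfolding r_def[symmetric] b_def[symmetric] u_def[symmetric] c_def[symmetric] by linarith
  also have "\<dots> = int (n\<^sup>2 + 2 * (C + 2) * n)" by (simp add: n_def r_def b_def u_def c_def algebra_simps)
  finally show ?thesis by linarith
qed

text \<open>While \<open>U\<close> has edges to both \<open>R\<close> and \<open>B\<close>, a pair
  is removed. As soon as \<open>U\<close> has no edge to one of them, that class is detached from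
  everything else, because no edge joins \<open>R\<close> and \<open>B\<close>. The summand 1 in the
  size conditions leaves room for a removal when both classes have equal size.\<close>

lemma three_class_bound:
  assumes "simple_on (R \<union> B \<union> U) E" "low_codegree C U E"
    and "R \<inter> B = {}" "R \<inter> U = {}" "B \<inter> U = {}"
    and "\<And>x y. x \<in> B \<Longrightarrow> y \<in> R \<Longrightarrow> {x, y} \<notin> E"
    and "card R \<le> card B + card U + 1" "card B \<le> card R + card U + 1"
  shows "4 * card E \<le> (card R + card B + card U)\<^sup>2 + 2 * (C + 2) * (card R + card B + card U)"
  using assms
proof (induction "card U" arbitrary: R B U E rule: less_induct)
  case less
  have fin: "finite B" "finite U" "finite R" using less.prems by (auto simp: simple_on_def)
  have cV: "card (R \<union> B \<union> U) = card R + card B + card U"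
    using fin less.prems(3-5) by (simp add: card_Un_disjoint Int_Un_distrib2)
  \<comment> \<open>Removing an edge at the larger of the two classes keeps both size conditions.\<close>
  have step: ?case if B: "X = B \<and> Y = R \<or> X = R \<and> Y = B" and le: "card Y \<le> card X"
    and e: "x \<in> U" "y \<in> X" "{x, y} \<in> E" for X Y x y
  proof -
    have V: "R \<union> B \<union> U = Y \<union> X \<union> U" using B by auto
    have disj: "Y \<inter> X = {}" "Y \<inter> U = {}" "X \<inter> U = {}" using B less.prems(3-5) by auto
    obtain U' X' E' where st: "simple_on (Y \<union> X' \<union> U') E'" "low_codegree C U' E'"
      "U' \<subseteq> U" "X' \<subseteq> X" "E' \<subseteq> E" "card U = Suc (card U')" "card X = Suc (card X')"
      "4 * card E \<le> 4 * card E' + 4 * card (Y \<union> X \<union> U) + 4 * C"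
      using two_class_step[OF less.prems(1,2) e V disj] by metis
    have no: "{x, y} \<notin> E'" if "x \<in> X'" "y \<in> Y" for x y
      using that st(4,5) less.prems(6)[of x y] less.prems(6)[of y x] B by (auto simp: insert_commute)
    have "4 * card E' \<le> (card Y + card X' + card U')\<^sup>2 + 2 * (C + 2) * (card Y + card X' + card U')"
    proof (rule less.hyps[OF _ st(1,2)])
      show "card Y \<le> card X' + card U' + 1" using le st by linarith
      show "card X' \<le> card Y + card U' + 1" using less.prems(7,8) B st by auto
    qed (use st disj no in auto)
    moreover have "card R + card B + card U = card Y + card X' + card U' + 2" using B st by auto
    ultimately show ?thesis using st(8) unfolding V[symmetric] cV
      by (simp add: power2_eq_square algebra_simps)
  qed
  show ?case
  proof (cases "\<exists>x\<in>U. \<exists>y\<in>B. {x, y} \<in> E")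
    case noB: False
    then have "{x, y} \<notin> E" if "x \<in> B" "y \<in> R \<union> U" for x y
      using that less.prems(6) by (metis Un_iff insert_commute)
    then show ?thesis using less.prems by (intro detached_class_bound) auto
  next
    case B: True
    show ?thesis
    proof (cases "\<exists>x\<in>U. \<exists>y\<in>R. {x, y} \<in> E")
      case True
      then show ?thesis using B step[of B R] step[of R B] by (meson nle_le)
    next
      case False
      then have "{x, y} \<notin> E" if "x \<in> R" "y \<in> B \<union> U" for x y
        using that less.prems(6) by (metis Un_iff insert_commute)
      then have "4 * card E \<le> (card B + card R + card U)\<^sup>2 + 2 * (C + 2) * (card B + card R + card U)"
        using less.prems by (intro detached_class_bound) (auto simp: Un_commute)
      then show ?thesis by (simp add: add.commute)
    qed
  qed
qed

section \<open>Finding non-monochromatic cycles by pigeonhole\<close>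

text \<open>Double counting of the pairs of \<open>v\<close> in \<open>S\<close> and
  \<open>x\<close> in \<open>Q v\<close>: there are at least
  \<open>\<delta> * card X * card S\<close> of them, so some \<open>x\<close> receives at least the
  average share.\<close>

lemma popular_element:
  fixes \<delta> :: real
  assumes "finite X" "X \<noteq> {}" "finite S"
    and Q: "\<And>v. v \<in> S \<Longrightarrow> Q v \<subseteq> X" "\<And>v. v \<in> S \<Longrightarrow> \<delta> * card X \<le> card (Q v)"
  shows "\<exists>x\<in>X. \<delta> * card S \<le> card {v \<in> S. x \<in> Q v}"
proof (rule ccontr)
  assume "\<not> ?thesis"
  then have "(\<Sum>x\<in>X. real (card {v \<in> S. x \<in> Q v})) < (\<Sum>x\<in>X. \<delta> * card S)"
    using assms by (intro sum_strict_mono) auto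
  moreover have "(\<Sum>x\<in>X. card {v \<in> S. x \<in> Q v}) = (\<Sum>v\<in>S. card {x \<in> X. x \<in> Q v})"
    using assms by (intro sum_multicount_gen) auto
  then have "(\<Sum>x\<in>X. real (card {v \<in> S. x \<in> Q v})) = (\<Sum>v\<in>S. real (card {x \<in> X. x \<in> Q v}))"
    by (metis (mono_tags) of_nat_sum)
  moreover have "\<dots> = (\<Sum>v\<in>S. real (card (Q v)))"
    using Q(1) by (intro sum.cong refl arg_cong[of _ _ "\<lambda>A. real (card A)"]) auto
  moreover have "(\<Sum>v\<in>S. \<delta> * card X) \<le> (\<Sum>v\<in>S. real (card (Q v)))"
    using Q(2) by (rule sum_mono)
  ultimately show False by (simp add: mult_ac)
qed

text \<open>Iterates \<open>popular_element\<close>, each round keeping a fraction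
  \<open>\<delta> / 2\<close> of the vertices. By the assumption on \<open>card F + m\<close>, the
  set \<open>F\<close> and the elements chosen so far fill at most half of each \<open>Q v\<close>,
  so the next element can be new.\<close>

lemma popular_subset:
  fixes \<delta> :: real
  assumes X: "finite X" "X \<noteq> {}" and S: "finite S" and F: "finite F" and \<delta>: "0 < \<delta>" "\<delta> \<le> 1"
    and Q: "\<And>v. v \<in> S \<Longrightarrow> Q v \<subseteq> X" "\<And>v. v \<in> S \<Longrightarrow> \<delta> * card X \<le> card (Q v)"
    and m: "card F + m \<le> \<delta> / 2 * card X"
  shows "\<exists>W T. W \<subseteq> X - F \<and> card W = m \<and> T \<subseteq> S \<and> (\<delta> / 2) ^ m * card S \<le> card T \<and> (\<forall>v\<in>T. W \<subseteq> Q v)"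
  using m
proof (induction m)
  case 0
  show ?case by (rule exI[of _ "{}"], rule exI[of _ S]) auto
next
  case (Suc m)
  then obtain W T where W: "W \<subseteq> X - F" "card W = m" "T \<subseteq> S" "(\<delta> / 2) ^ m * card S \<le> card T"
    "\<forall>v\<in>T. W \<subseteq> Q v" by auto
  have fin: "finite W" "finite T" using W X S by (meson finite_Diff finite_subset)+
  have "\<exists>x\<in>X. \<delta> / 2 * card T \<le> card {v \<in> T. x \<in> Q v - (F \<union> W)}"
  proof (rule popular_element)
    fix v assume v: "v \<in> T"
    then show "Q v - (F \<union> W) \<subseteq> X" using Q W by auto
    have "card (Q v) - card (F \<union> W) \<le> card (Q v - (F \<union> W))"
      using fin F by (intro diff_card_le_card_Diff) auto
    moreover have "card (F \<union> W) \<le> card F + m" using card_Un_le[of F W] W by simp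
    moreover have "\<delta> * card X \<le> card (Q v)" using Q v W by auto
    ultimately show "\<delta> / 2 * card X \<le> card (Q v - (F \<union> W))" using Suc.prems by linarith
  qed (use X fin in auto)
  then obtain x where x: "x \<in> X" "\<delta> / 2 * card T \<le> card {v \<in> T. x \<in> Q v - (F \<union> W)}" by auto
  let ?T = "{v \<in> T. x \<in> Q v - (F \<union> W)}"
  have "(\<delta> / 2) ^ Suc m * card S \<le> \<delta> / 2 * card T" using W(4) \<delta> by simp
  also note x(2)
  finally have T: "(\<delta> / 2) ^ Suc m * card S \<le> card ?T" .
  show ?case
  proof (cases "?T = {}")
    case False
    then have "x \<notin> F \<union> W" by auto
    then show ?thesis using x W T fin
      by (intro exI[of _ "insert x W"] exI[of _ ?T]) auto
  next
    \<comment> \<open>If no vertex survives, the popular \<open>x\<close> may lie in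
      \<open>F\<close> or \<open>W\<close>. The required lower bound is then not positive, and any
      \<open>Suc m\<close> elements outside \<open>F\<close> serve, with the empty set of
      vertices.\<close>
    case True
    have "Suc m \<le> card (X - F)"
    proof -
      have "card X - card F \<le> card (X - F)" using F by (rule diff_card_le_card_Diff)
      moreover have "\<delta> / 2 * card X \<le> 1 * real (card X)" using \<delta> by (intro mult_right_mono) auto
      ultimately show ?thesis using Suc.prems by linarith
    qed
    then obtain W' where "W' \<subseteq> X - F" "card W' = Suc m" by (meson obtain_subset_with_card_n)
    then show ?thesis using T unfolding True by (intro exI[of _ W'] exI[of _ "{}"]) auto
  qed
qed

section \<open>Assembling a forbidden cycle from shared neighbours and a path\<close>

lemma contains_non_mono_cycle:
  fixes G :: "nat bgraph"
  assumes G: "bicolored_graph G" and inj: "inj_on v {..<k}"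
    and edge: "\<And>i. i < k \<Longrightarrow> {v i, v (Suc i mod k)} \<in> edges G"
    and "i < k" "{v i, v (Suc i mod k)} \<in> colour_class G a"
    and "j < k" "{v j, v (Suc j mod k)} \<in> colour_class G b" and "a \<noteq> b"
  shows "\<exists>F\<in>non_mono_cycles k. contains G F"
proof
  \<comment> \<open>The cycle takes its vertices and colours from \<open>G\<close> itself, so the
    identity embeds it.\<close>
  define F where "F = \<lparr>verts = v ` {..<k}, edges = {{v i, v (Suc i mod k)} | i. i < k}, colour_of = colour_of G\<rparr>"
  have sub: "edges F \<subseteq> edges G" using edge by (auto simp: F_def)
  have "v i \<in> verts G" if "i < k" for i
    using edge[OF that] G by (auto simp: bicolored_graph_def)
  then have "verts F \<subseteq> verts G" by (auto simp: F_def)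
  with sub show "contains G F"
    unfolding contains_def by (intro exI[of _ id]) (auto simp: F_def)
  have "e \<subseteq> verts F" if "e \<in> edges F" for e
    using that by (auto simp: F_def)
  moreover have "card e = 2" if "e \<in> edges F" for e
    using that sub G by (auto simp: bicolored_graph_def)
  ultimately have "bicolored_graph F" by (auto simp: bicolored_graph_def F_def)
  moreover have "is_cycle k F"
    using inj by (auto simp: is_cycle_def F_def bij_betw_def)
  moreover have "non_monochromatic F"
  proof -
    have "{v i, v (Suc i mod k)} \<in> colour_class F a" "{v j, v (Suc j mod k)} \<in> colour_class F b"
      using assms(4-7) by (auto simp: F_def colour_class_def)
    moreover have "c = a \<or> c = b" for c using \<open>a \<noteq> b\<close> by (cases a; cases b; cases c) auto
    ultimately show ?thesis unfolding non_monochromatic_def by (metis empty_iff)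
  qed
  ultimately show "F \<in> non_mono_cycles k" by (simp add: non_mono_cycles_def)
qed

lemma edges_of_class: "e \<in> colour_class G c \<Longrightarrow> e \<in> edges G"
  by (simp add: colour_class_def)

text \<open>The cycle is \<open>s\<^sub>0 w\<^sub>0 s\<^sub>1 w\<^sub>1 \<dots> w\<^bsub>t-2\<^esub> s\<^bsub>t-1\<^esub> p\<^sub>0 \<dots> p\<^bsub>q-1\<^esub>\<close>.\<close>

lemma cycle_through_path:
  fixes G :: "nat bgraph"
  assumes G: "bicolored_graph G" and "t \<ge> 2" "q \<ge> 1"
    and S: "t \<le> card S" and W: "card W = t - 1"
    and p: "inj_on p {..<q}" "p ` {..<q} \<inter> W = {}" "\<And>j. Suc j < q \<Longrightarrow> {p j, p (Suc j)} \<in> edges G"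
    and Sp: "\<And>v j. v \<in> S \<Longrightarrow> j < q \<Longrightarrow> {v, p j} \<in> edges G"
    and SW: "\<And>v w. v \<in> S \<Longrightarrow> w \<in> W \<Longrightarrow> {v, w} \<in> colour_class G a"
    and b: "(\<forall>v\<in>S. {v, p 0} \<in> colour_class G b) \<or> (\<exists>j. Suc j < q \<and> {p j, p (Suc j)} \<in> colour_class G b)"
    and "a \<noteq> b"
  shows "\<exists>F\<in>non_mono_cycles (2 * t - 1 + q). contains G F"
proof -
  have noloop: "{x} \<notin> edges G" for x using G by (auto simp: bicolored_graph_def)
  obtain S' where S': "S' \<subseteq> S" "card S' = t" "finite S'"
    using S by (meson obtain_subset_with_card_n)
  obtain s where s: "bij_betw s {..<t} S'"
    using S' by (metis card_lessThan finite_lessThan finite_same_card_bij)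
  have "finite W" using W \<open>t \<ge> 2\<close> by (intro card_ge_0_finite) auto
  then obtain w where w: "bij_betw w {..<t - 1} W"
    using W by (metis card_lessThan finite_lessThan finite_same_card_bij)
  \<comment> \<open>The zigzag occupies the first \<open>2 * t - 1\<close> positions, with
    \<open>s\<close> at even and \<open>w\<close> at odd ones; it starts and ends in
    \<open>S\<close>. The path \<open>p\<close> fills the remaining \<open>q\<close>
    positions.\<close>
  define h where "h = 2 * t - 1"
  define k where "k = h + q"
  have h: "0 < h" "Suc h = 2 * t" using \<open>t \<ge> 2\<close> by (auto simp: h_def)
  define v where "v i = (if i < h then (if even i then s (i div 2) else w (i div 2)) else p (i - h))" for i
  have sS: "s i \<in> S" if "i < t" for i using that s S' by (auto simp: bij_betw_def)
  have wW: "w i \<in> W" if "i < t - 1" for i using that w by (auto simp: bij_betw_def)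
  have sw: "{s i, w j} \<in> edges G" if "i < t" "j < t - 1" for i j
    using SW[OF sS wW, OF that] by (rule edges_of_class)
  \<comment> \<open>Vertices of \<open>S\<close> differ from those of \<open>W\<close> and of the
    path because they are adjacent to them and there are no loops.\<close>
  have ne: "s i \<noteq> w j" if "i < t" "j < t - 1" for i j
    using sw[OF that] noloop by auto
  have ne': "s i \<noteq> p j" if "i < t" "j < q" for i j
    using Sp[OF sS that(2), of i] that noloop by auto
  have ne'': "w i \<noteq> p j" if "i < t - 1" "j < q" for i j
    using p(2) wW that by auto
  have "inj_on v {..<k}"
  proof (rule inj_onI)
    fix i j assume ij: "i \<in> {..<k}" "j \<in> {..<k}" "v i = v j"
    have half: "i div 2 < t" if "i < h" for i using that h by auto
    have half': "i div 2 < t - 1" if "i < h" "odd i" for i using that h by (auto elim!: oddE)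
    have sinj: "i = j" if "s i = s j" "i < t" "j < t" for i j
      using s that by (auto simp: bij_betw_def inj_on_def)
    have winj: "i = j" if "w i = w j" "i < t - 1" "j < t - 1" for i j
      using w that by (auto simp: bij_betw_def inj_on_def)
    have pinj: "i = j" if "p i = p j" "i < q" "j < q" for i j
      using p(1) that by (auto simp: inj_on_def)
    consider "i < h" "j < h" | "i < h" "\<not> j < h"
      | "\<not> i < h" "j < h" | "\<not> i < h" "\<not> j < h" by auto
    then show "i = j"
    proof cases
      case 1
      then have "i div 2 = j div 2 \<and> (even i \<longleftrightarrow> even j)"
        using ij(3) sinj winj ne half half' unfolding v_def
        by (smt (verit, best))
      then show ?thesis by (metis div_mult_mod_eq even_iff_mod_2_eq_zero odd_iff_mod_2_eq_one)
    next
      case 2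
      then have "j - h < q" using ij by (auto simp: k_def)
      then show ?thesis using 2 ij(3) ne' ne'' half half' unfolding v_def by (smt (verit, best))
    next
      case 3
      then have "i - h < q" using ij by (auto simp: k_def)
      then show ?thesis using 3 ij(3) ne' ne'' half half' unfolding v_def by (smt (verit, best))
    next
      case 4
      have "i - h = j - h"
        by (rule pinj) (use 4 ij in \<open>auto simp: v_def k_def\<close>)
      with 4 show ?thesis by linarith
    qed
  qed
  moreover have "{v i, v (Suc i mod k)} \<in> edges G" if i: "i < k" for i
  proof -
    \<comment> \<open>Five kinds of edges: from \<open>s\<close> to \<open>w\<close>, from
      \<open>w\<close> to \<open>s\<close>, from the last \<open>s\<close> into the path, along the
      path, and from its end back to \<open>s 0\<close>.\<close>
    consider "Suc i < h" "even i" | "Suc i < h" "odd i" | "Suc i = h"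
      | "h \<le> i" "Suc i < k" | "Suc i = k"
      using i by linarith
    then show ?thesis
    proof cases
      case 1
      then obtain m where "i = 2 * m" by auto
      moreover from this have "v i = s m" "v (Suc i mod k) = w m" "m < t - 1"
        using 1 h by (auto simp: v_def k_def)
      ultimately show ?thesis using sw[of m m] by auto
    next
      case 2
      then obtain m where "i = 2 * m + 1" by (auto elim: oddE)
      moreover from this have "v i = w m" "v (Suc i mod k) = s (Suc m)" "Suc m < t"
        using 2 h by (auto simp: v_def k_def)
      ultimately show ?thesis using sw[of "Suc m" m] by (auto simp: insert_commute)
    next
      case 3
      then have i2: "i = 2 * (t - 1)" using h by auto
      then have "v i = s (t - 1)" using 3 by (auto simp: v_def)
      moreover have "v (Suc i mod k) = p 0" using 3 \<open>q \<ge> 1\<close> by (auto simp: v_def k_def)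
      ultimately show ?thesis using Sp[OF sS, of "t - 1" 0] assms(2,3) by auto
    next
      case 4
      then have "v i = p (i - h)" "v (Suc i mod k) = p (Suc (i - h))"
        by (auto simp: v_def Suc_diff_le)
      then show ?thesis using p(3)[of "i - h"] 4 by (auto simp: k_def)
    next
      case 5
      then have "i = h + (q - 1)" using \<open>q \<ge> 1\<close> by (auto simp: k_def)
      then have "v i = p (q - 1)" by (auto simp: v_def)
      moreover have "v (Suc i mod k) = s 0" using 5 h by (auto simp: v_def)
      ultimately show ?thesis using Sp[OF sS, of 0 "q - 1"] assms(2,3) by (auto simp: insert_commute)
    qed
  qed
  moreover have "0 < k" "{v 0, v (Suc 0 mod k)} \<in> colour_class G a"
  proof -
    show "0 < k" using h by (simp add: k_def)
    have "v 0 = s 0" "v (Suc 0 mod k) = w 0" using h \<open>t \<ge> 2\<close> by (auto simp: v_def k_def)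
    then show "{v 0, v (Suc 0 mod k)} \<in> colour_class G a"
      using SW[OF sS wW, of 0 0] \<open>t \<ge> 2\<close> by auto
  qed
  \<comment> \<open>Colour \<open>a\<close> was found on the edge from \<open>s 0\<close> to
    \<open>w 0\<close>. Colour \<open>b\<close> occurs where the zigzag enters the path or on an
    edge of the path.\<close>
  moreover have "\<exists>j<k. {v j, v (Suc j mod k)} \<in> colour_class G b"
    using b
  proof
    assume *: "\<forall>v\<in>S. {v, p 0} \<in> colour_class G b"
    have i2: "h - 1 = 2 * (t - 1)" "Suc (h - 1) = h" using h by auto
    then have "v (h - 1) = s (t - 1)" using h(1) by (auto simp: v_def)
    moreover have "h - 1 < k" "v (Suc (h - 1) mod k) = p 0"
      unfolding i2(2) using h \<open>q \<ge> 1\<close> by (auto simp: v_def k_def)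
    ultimately show ?thesis using * sS[of "t - 1"] \<open>t \<ge> 2\<close> by (intro exI[of _ "h - 1"]) auto
  next
    assume "\<exists>j. Suc j < q \<and> {p j, p (Suc j)} \<in> colour_class G b"
    then obtain j where j: "Suc j < q" "{p j, p (Suc j)} \<in> colour_class G b" by auto
    have "h + j < k" "v (h + j) = p j" "v (Suc (h + j) mod k) = p (Suc j)"
      using j by (auto simp: v_def k_def)
    then show ?thesis using j by metis
  qed
  ultimately show ?thesis
    using contains_non_mono_cycle[OF G] \<open>a \<noteq> b\<close> unfolding k_def h_def by metis
qed

section \<open>Vertices whose abundance would force a forbidden cycle\<close>

definition triangle_pairs :: "'a set set \<Rightarrow> 'a set set \<Rightarrow> 'a \<Rightarrow> ('a \<times> 'a) set" where
  "triangle_pairs E K v = {(y, z). y \<in> nbrs E v \<and> z \<in> nbrs E v \<and> {y, z} \<in> K}"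

lemma simple_on_graph: "bicolored_graph G \<Longrightarrow> simple_on (verts G) (edges G)"
  by (simp add: bicolored_graph_def simple_on_def)

lemma colour_class_subset: "colour_class G c \<subseteq> edges G"
  by (auto simp: colour_class_def)

lemma simple_on_colour_class: "bicolored_graph G \<Longrightarrow> simple_on (verts G) (colour_class G c)"
  using simple_on_mono[OF simple_on_graph colour_class_subset] .

lemma edges_eq_classes: "edges G = colour_class G Red \<union> colour_class G Blue"
proof -
  have "c = Red \<or> c = Blue" for c by (cases c) auto
  then show ?thesis by (auto simp: colour_class_def)
qed

text \<open>First a closing object \<open>x\<close> shared by a fraction \<open>\<delta>\<close> of
  \<open>S\<close> is fixed, then \<open>popular_subset\<close> yields \<open>W\<close>. For even
  cycles \<open>X\<close> consists of vertices, for odd ones of ordered pairs of vertices;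
  \<open>F x\<close> collects the vertices used by \<open>x\<close>, which \<open>W\<close> has to
  avoid. Of the two factors \<open>\<delta>\<close> in the bound on \<open>M\<close>, one is the
  density of \<open>S\<close> and one the choice of \<open>x\<close>.\<close>

lemma popular_configuration:
  fixes \<delta> :: real
  assumes X: "finite X" "X \<noteq> {}" and V: "finite V" "V \<noteq> {}"
    and S: "finite S" "\<delta> * card V \<le> card S" and \<delta>: "0 < \<delta>" "\<delta> \<le> 1"
    and P: "\<And>v. v \<in> S \<Longrightarrow> P v \<subseteq> X" "\<And>v. v \<in> S \<Longrightarrow> \<delta> * card X \<le> card (P v)"
    and Q: "\<And>v. v \<in> S \<Longrightarrow> Q v \<subseteq> V" "\<And>v. v \<in> S \<Longrightarrow> \<delta> * card V \<le> card (Q v)"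
    and F: "\<And>x. finite (F x)" "\<And>x. card (F x) \<le> 2"
    and m: "m + 2 \<le> \<delta> / 2 * card V" and M: "M \<le> (\<delta> / 2) ^ m * \<delta> * \<delta> * card V"
  obtains x W T where "x \<in> X" "W \<subseteq> V - F x" "card W = m" "T \<subseteq> S" "M \<le> card T"
    "\<And>v. v \<in> T \<Longrightarrow> x \<in> P v \<and> W \<subseteq> Q v"
proof -
  obtain x where x: "x \<in> X" "\<delta> * card S \<le> card {v \<in> S. x \<in> P v}"
    using popular_element[OF X S(1), of P \<delta>] P by blast
  let ?S = "{v \<in> S. x \<in> P v}"
  have "card (F x) + m \<le> \<delta> / 2 * card V" using F(2)[of x] m by linarith
  then have "\<exists>W T. W \<subseteq> V - F x \<and> card W = m \<and> T \<subseteq> ?S \<and> (\<delta> / 2) ^ m * card ?S \<le> card T \<and> (\<forall>v\<in>T. W \<subseteq> Q v)"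
    using V S F \<delta> Q by (intro popular_subset) auto
  then obtain W T where W: "W \<subseteq> V - F x" "card W = m" "T \<subseteq> ?S" "(\<delta> / 2) ^ m * card ?S \<le> card T"
    "\<forall>v\<in>T. W \<subseteq> Q v" by auto
  have "M \<le> (\<delta> / 2) ^ m * (\<delta> * (\<delta> * card V))" using M by (simp add: mult_ac)
  also have "\<dots> \<le> (\<delta> / 2) ^ m * (\<delta> * card S)" using S \<delta> by (intro mult_left_mono) auto
  also have "\<dots> \<le> (\<delta> / 2) ^ m * card ?S" using x \<delta> by (intro mult_left_mono) auto
  also note W(4)
  finally have "M \<le> card T" by simp
  with that[of x W T] x W show ?thesis by auto
qed

lemma eventually_linear_ge:
  fixes a c :: real
  assumes "0 < a"
  shows "\<forall>\<^sub>F n in sequentially. c \<le> a * real n"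
proof -
  have "filterlim (\<lambda>n. a * real n) at_top sequentially"
    using assms filterlim_real_sequentially by (intro filterlim_tendsto_pos_mult_at_top[OF tendsto_const])
  then show ?thesis by (simp add: filterlim_at_top)
qed

text \<open>Otherwise \<open>t\<close> such vertices share a red neighbour \<open>c\<close> and
  \<open>t - 1\<close> blue neighbours. The zigzag between them, closed through the one-vertex path
  \<open>c\<close>, is a cycle of length \<open>2 * t\<close> in both colours.\<close>

lemma few_two_coloured_vertices:
  fixes \<delta> :: real
  assumes "2 \<le> t" and \<delta>: "0 < \<delta>" "\<delta> \<le> 1"
  shows "\<forall>\<^sub>F n in sequentially. \<forall>G :: nat bgraph. bicolored_graph G \<longrightarrow> card (verts G) = n \<longrightarrow>
     (\<forall>F\<in>non_mono_cycles (2 * t). \<not> contains G F) \<longrightarrow>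
     card {v \<in> verts G. \<delta> * n \<le> card (nbrs (colour_class G Red) v) \<and>
       \<delta> * n \<le> card (nbrs (colour_class G Blue) v)} < \<delta> * n"
proof -
  \<comment> \<open>The two size requirements of \<open>popular_configuration\<close> for
    \<open>m = t - 1\<close> and \<open>M = t\<close>; both hold for large \<open>n\<close> because
    their right-hand sides are linear in \<open>n\<close>.\<close>
  have "\<forall>\<^sub>F n in sequentially. real (t - 1 + 2) \<le> \<delta> / 2 * real n"
    "\<forall>\<^sub>F n in sequentially. real t \<le> (\<delta> / 2) ^ (t - 1) * \<delta> * \<delta> * real n"
    using \<delta> by (intro eventually_linear_ge; simp)+
  then show ?thesis using eventually_gt_at_top[of 0]
  proof eventually_elim
    case (elim n)
    show ?case
    proof (intro allI impI, rule ccontr)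
      fix G :: "nat bgraph"
      let ?R = "nbrs (colour_class G Red)" and ?B = "nbrs (colour_class G Blue)"
      let ?S = "{v \<in> verts G. \<delta> * n \<le> card (?R v) \<and> \<delta> * n \<le> card (?B v)}"
      assume G: "bicolored_graph G" and n: "card (verts G) = n"
        and free: "\<forall>F\<in>non_mono_cycles (2 * t). \<not> contains G F" and S: "\<not> card ?S < \<delta> * n"
      have V: "finite (verts G)" "verts G \<noteq> {}" using elim n by (auto intro: card_ge_0_finite)
      note sub = nbrs_subset[OF simple_on_colour_class[OF G]]
      obtain c W T where T: "c \<in> verts G" "W \<subseteq> verts G - {c}" "card W = t - 1" "T \<subseteq> ?S" "t \<le> card T"
        "\<And>v. v \<in> T \<Longrightarrow> c \<in> ?R v \<and> W \<subseteq> ?B v"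
        by (rule popular_configuration[of "verts G" "verts G" ?S \<delta> ?R ?B "\<lambda>c. {c}" "t - 1" t])
          (use V \<delta> S elim n sub in auto)
      have "\<exists>F\<in>non_mono_cycles (2 * t - 1 + 1). contains G F"
        by (rule cycle_through_path[OF G, of _ _ T W "\<lambda>_. c" Blue Red])
          (use T \<open>2 \<le> t\<close> in \<open>auto simp: nbrs_def inj_on_def intro: edges_of_class\<close>)
      with free \<open>2 \<le> t\<close> show False by simp
    qed
  qed
qed

text \<open>As in the even case, but the zigzag is closed through a shared edge
  \<open>{y, z}\<close> of colour \<open>a\<close>, which gives length \<open>2 * t + 1\<close>. The
  edges from the zigzag to \<open>y\<close> and \<open>z\<close> may have any colour:
  \<open>a\<close> occurs on \<open>{y, z}\<close> and \<open>b\<close> on the edges to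
  \<open>W\<close>.\<close>

lemma few_triangle_vertices:
  fixes \<delta> :: real
  assumes "2 \<le> t" and \<delta>: "0 < \<delta>" "\<delta> \<le> 1" and "a \<noteq> b"
  shows "\<forall>\<^sub>F n in sequentially. \<forall>G :: nat bgraph. bicolored_graph G \<longrightarrow> card (verts G) = n \<longrightarrow>
     (\<forall>F\<in>non_mono_cycles (2 * t + 1). \<not> contains G F) \<longrightarrow>
     card {v \<in> verts G. \<delta> * n\<^sup>2 \<le> card (triangle_pairs (edges G) (colour_class G a) v) \<and>
       \<delta> * n \<le> card (nbrs (colour_class G b) v)} < \<delta> * n"
proof -
  have "\<forall>\<^sub>F n in sequentially. real (t - 1 + 2) \<le> \<delta> / 2 * real n"
    "\<forall>\<^sub>F n in sequentially. real t \<le> (\<delta> / 2) ^ (t - 1) * \<delta> * \<delta> * real n"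
    using \<delta> by (intro eventually_linear_ge; simp)+
  then show ?thesis using eventually_gt_at_top[of 0]
  proof eventually_elim
    case (elim n)
    show ?case
    proof (intro allI impI, rule ccontr)
      fix G :: "nat bgraph"
      let ?P = "triangle_pairs (edges G) (colour_class G a)" and ?B = "nbrs (colour_class G b)"
      let ?S = "{v \<in> verts G. \<delta> * n\<^sup>2 \<le> card (?P v) \<and> \<delta> * n \<le> card (?B v)}"
      assume G: "bicolored_graph G" and n: "card (verts G) = n"
        and free: "\<forall>F\<in>non_mono_cycles (2 * t + 1). \<not> contains G F" and S: "\<not> card ?S < \<delta> * n"
      have V: "finite (verts G)" "verts G \<noteq> {}" using elim n by (auto intro: card_ge_0_finite)
      note sub = nbrs_subset[OF simple_on_colour_class[OF G]]
      have subP: "?P v \<subseteq> verts G \<times> verts G" for v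
        using nbrs_subset[OF simple_on_graph[OF G], of v] by (auto simp: triangle_pairs_def)
      have c2: "card {y, z} \<le> 2" for y z :: nat by (simp add: card_insert_if)
      obtain yz W T where T: "yz \<in> verts G \<times> verts G" "W \<subseteq> verts G - {fst yz, snd yz}" "card W = t - 1"
        "T \<subseteq> ?S" "t \<le> card T" "\<And>v. v \<in> T \<Longrightarrow> yz \<in> ?P v \<and> W \<subseteq> ?B v"
        by (rule popular_configuration[of "verts G \<times> verts G" "verts G" ?S \<delta> ?P ?B "\<lambda>p. {fst p, snd p}" "t - 1" t])
          (use V \<delta> S elim n sub subP c2 in \<open>auto simp: card_cartesian_product power2_eq_square\<close>)
      obtain y z where yz: "yz = (y, z)" by fastforce
      have "T \<noteq> {}" using T(5) \<open>2 \<le> t\<close> by auto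
      then have e: "{y, z} \<in> colour_class G a" using T(6) by (auto simp: triangle_pairs_def yz)
      then have "y \<noteq> z" using nbrs_irrefl[OF simple_on_colour_class[OF G]] by blast
      have P: "{v, y} \<in> edges G" "{v, z} \<in> edges G" if "v \<in> T" for v
        using T(6)[OF that] by (auto simp: triangle_pairs_def yz nbrs_def)
      define p where "p j = (if j = 0 then y else z)" for j :: nat
      have "\<exists>F\<in>non_mono_cycles (2 * t - 1 + 2). contains G F"
      proof (rule cycle_through_path[OF G, of _ _ T W p b a])
        show "(\<forall>v\<in>T. {v, p 0} \<in> colour_class G a) \<or> (\<exists>j. Suc j < 2 \<and> {p j, p (Suc j)} \<in> colour_class G a)"
          using e by (auto simp: p_def intro!: exI[of _ 0])
        show "p ` {..<2} \<inter> W = {}" using T(2) by (auto simp: p_def yz)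
        show "inj_on p {..<2}" using \<open>y \<noteq> z\<close> by (auto simp: p_def inj_on_def)
        show "{p j, p (Suc j)} \<in> edges G" if "Suc j < 2" for j
          using that edges_of_class[OF e] by (auto simp: p_def)
        show "{v, p j} \<in> edges G" if "v \<in> T" for v j
          using P[OF that] by (auto simp: p_def)
        show "{v, w} \<in> colour_class G b" if "v \<in> T" "w \<in> W" for v w
          using T(6) that by (auto simp: nbrs_def)
      qed (use T \<open>2 \<le> t\<close> \<open>a \<noteq> b\<close> in auto)
      moreover have "2 * t - 1 + 2 = 2 * t + 1" using \<open>2 \<le> t\<close> by auto
      ultimately show False using free by metis
    qed
  qed
qed

section \<open>Approximate structure of graphs without forbidden cycles\<close>

definition almost_structured :: "real \<Rightarrow> 'a bgraph \<Rightarrow> bool" where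
  "almost_structured d G \<longleftrightarrow> (\<exists>X \<subseteq> verts G. real (card X) \<le> d \<and>
     (\<forall>v \<in> verts G - X. real (card (nbrs (colour_class G Red) v)) \<le> d \<or>
        real (card (nbrs (colour_class G Blue) v)) \<le> d \<or>
        real (card (triangle_pairs (edges G) (edges G) v)) \<le> d\<^sup>2))"

text \<open>For even \<open>k\<close> the exceptional set is that of
  \<open>few_two_coloured_vertices\<close>. For odd \<open>k\<close>,
  \<open>few_triangle_vertices\<close> is applied with both orders of the colours: a remaining
  vertex of large degree in both colours lies in few triangles whose opposite edge is red, and in
  few where it is blue.\<close>

lemma almost_structured_if_free:
  fixes \<eta> :: real
  assumes "4 \<le> k" and \<eta>: "0 < \<eta>" "\<eta> \<le> 1"
  shows "\<forall>\<^sub>F n in sequentially. \<forall>G :: nat bgraph. bicolored_graph G \<longrightarrow> card (verts G) = n \<longrightarrow>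
     (\<forall>F\<in>non_mono_cycles k. \<not> contains G F) \<longrightarrow> almost_structured (\<eta> * n) G"
proof (cases "even k")
  case True
  then obtain t where t: "k = 2 * t" by auto
  with \<open>4 \<le> k\<close> have "2 \<le> t" by simp
  from few_two_coloured_vertices[OF this \<eta>] show ?thesis
  proof eventually_elim
    case (elim n)
    show ?case
    proof (intro allI impI)
      fix G :: "nat bgraph"
      assume G: "bicolored_graph G" "card (verts G) = n" "\<forall>F\<in>non_mono_cycles k. \<not> contains G F"
      let ?X = "{v \<in> verts G. \<eta> * n \<le> card (nbrs (colour_class G Red) v) \<and>
        \<eta> * n \<le> card (nbrs (colour_class G Blue) v)}"
      have "card ?X < \<eta> * n" using elim G t by blast
      then show "almost_structured (\<eta> * n) G" unfolding almost_structured_def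
        by (intro exI[of _ ?X]) auto
    qed
  qed
next
  case False
  then obtain t where t: "k = 2 * t + 1" by (auto elim: oddE)
  with \<open>4 \<le> k\<close> have "2 \<le> t" by simp
  \<comment> \<open>Two triangle counts below \<open>\<delta> * n\<^sup>2\<close> then add up to at
    most \<open>(\<eta> * n)\<^sup>2\<close>, and as \<open>\<eta>\<^sup>2 \<le> \<eta>\<close>, two
    exceptional sets of size below \<open>\<delta> * n\<close> fit into
    \<open>\<eta> * n\<close>.\<close>
  define \<delta> where "\<delta> = \<eta>\<^sup>2 / 2"
  have \<eta>2: "\<eta>\<^sup>2 \<le> \<eta>" using \<eta> by (simp add: power2_eq_square mult_left_le)
  have \<delta>: "0 < \<delta>" "\<delta> \<le> 1" "2 * \<delta> \<le> \<eta>" "\<delta> \<le> \<eta>" using \<eta> \<eta>2 by (auto simp: \<delta>_def)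
  have "Red \<noteq> Blue" "Blue \<noteq> Red" by auto
  from this[THEN few_triangle_vertices[OF \<open>2 \<le> t\<close> \<delta>(1,2)]]
  have "\<forall>\<^sub>F n in sequentially. \<forall>G :: nat bgraph. bicolored_graph G \<longrightarrow> card (verts G) = n \<longrightarrow>
     (\<forall>F\<in>non_mono_cycles k. \<not> contains G F) \<longrightarrow>
     card {v \<in> verts G. \<delta> * n\<^sup>2 \<le> card (triangle_pairs (edges G) (colour_class G Red) v) \<and>
       \<delta> * n \<le> card (nbrs (colour_class G Blue) v)} < \<delta> * n \<and>
     card {v \<in> verts G. \<delta> * n\<^sup>2 \<le> card (triangle_pairs (edges G) (colour_class G Blue) v) \<and>
       \<delta> * n \<le> card (nbrs (colour_class G Red) v)} < \<delta> * n"
    unfolding t by eventually_elim blast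
  then show ?thesis
  proof eventually_elim
    case (elim n)
    show ?case
    proof (intro allI impI)
      fix G :: "nat bgraph"
      assume G: "bicolored_graph G" "card (verts G) = n" "\<forall>F\<in>non_mono_cycles k. \<not> contains G F"
      let ?N = "\<lambda>c. nbrs (colour_class G c)"
      let ?T = "\<lambda>K. triangle_pairs (edges G) K"
      let ?X = "\<lambda>a b. {v \<in> verts G. \<delta> * n\<^sup>2 \<le> card (?T (colour_class G a) v) \<and> \<delta> * n \<le> card (?N b v)}"
      let ?Y = "?X Red Blue \<union> ?X Blue Red"
      have "card (?X Red Blue) < \<delta> * n" "card (?X Blue Red) < \<delta> * n" using elim G by blast+
      moreover have "card ?Y \<le> card (?X Red Blue) + card (?X Blue Red)" by (rule card_Un_le)
      ultimately have "card ?Y \<le> 2 * \<delta> * n" by linarith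
      also have "\<dots> \<le> \<eta> * n" using \<delta> by (intro mult_right_mono) auto
      finally have Y: "card ?Y \<le> \<eta> * n" .
      have \<delta>n: "\<delta> * n \<le> \<eta> * n" using \<delta> by (intro mult_right_mono) auto
      have "card (?N Red v) \<le> \<eta> * n \<or> card (?N Blue v) \<le> \<eta> * n \<or> card (?T (edges G) v) \<le> (\<eta> * n)\<^sup>2"
        if v: "v \<in> verts G - ?Y" for v
      proof (rule ccontr)
        assume *: "\<not> ?thesis"
        have "card (?T (edges G) v) \<le> card (?T (colour_class G Red) v) + card (?T (colour_class G Blue) v)"
        proof -
          have "?T (edges G) v = ?T (colour_class G Red) v \<union> ?T (colour_class G Blue) v"
            unfolding triangle_pairs_def by (subst (3) edges_eq_classes) auto
          then show ?thesis by (metis card_Un_le)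
        qed
        moreover have "card (?T (colour_class G Red) v) < \<delta> * n\<^sup>2" "card (?T (colour_class G Blue) v) < \<delta> * n\<^sup>2"
          using v * \<delta>n by auto
        moreover have "(\<eta> * n)\<^sup>2 = \<delta> * n\<^sup>2 + \<delta> * n\<^sup>2" by (simp add: \<delta>_def power_mult_distrib)
        ultimately show False using * by linarith
      qed
      with Y show "almost_structured (\<eta> * n) G"
        unfolding almost_structured_def by (intro exI[of _ ?Y]) auto
    qed
  qed
qed

section \<open>The edge bound and the limit\<close>

text \<open>Each deleted edge is charged to an endpoint \<open>x\<close> whose set
  \<open>bad x\<close> contains the other endpoint.\<close>

lemma card_deleted_le:
  fixes bad :: "'a \<Rightarrow> 'a set"
  assumes E: "simple_on V E" and bad: "\<And>v. bad v \<subseteq> nbrs E v"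
  shows "card {e \<in> E. \<exists>x\<in>e. \<exists>y\<in>e. y \<in> bad x} \<le> (\<Sum>v\<in>V. card (bad v))"
proof -
  have fin: "finite V" "finite (bad v)" for v
    using E bad finite_subset[OF bad finite_nbrs[OF E]] by (auto simp: simple_on_def)
  have "{e \<in> E. \<exists>x\<in>e. \<exists>y\<in>e. y \<in> bad x} \<subseteq> (\<Union>v\<in>V. (\<lambda>y. {v, y}) ` bad v)"
  proof
    fix e assume "e \<in> {e \<in> E. \<exists>x\<in>e. \<exists>y\<in>e. y \<in> bad x}"
    then obtain x y where e: "e \<in> E" "x \<in> e" "y \<in> e" "y \<in> bad x" by auto
    then have "x \<noteq> y" using bad[of x] nbrs_irrefl[OF E, of x y] by (auto simp: nbrs_def)
    with e E have "e = {x, y}" "x \<in> V" by (auto elim!: simple_on_edgeE)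
    with e show "e \<in> (\<Union>v\<in>V. (\<lambda>y. {v, y}) ` bad v)" by auto
  qed
  then have "card {e \<in> E. \<exists>x\<in>e. \<exists>y\<in>e. y \<in> bad x} \<le> card (\<Union>v\<in>V. (\<lambda>y. {v, y}) ` bad v)"
    using fin by (intro card_mono) auto
  also have "\<dots> \<le> (\<Sum>v\<in>V. card ((\<lambda>y. {v, y}) ` bad v))" using fin by (intro card_UN_le)
  also have "\<dots> \<le> (\<Sum>v\<in>V. card (bad v))" using fin by (intro sum_mono card_image_le)
  finally show ?thesis .
qed

text \<open>Each \<open>y\<close> of codegree above \<open>d\<close> is the first component of more
  than \<open>d\<close> of the at most \<open>d\<^sup>2\<close> triangle pairs at
  \<open>v\<close>.\<close>

lemma card_high_codegree_le:
  fixes d :: real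
  assumes E: "simple_on V E" and "0 < d" and t: "card (triangle_pairs E E v) \<le> d\<^sup>2"
  shows "card {y \<in> nbrs E v. d < card (nbrs E v \<inter> nbrs E y)} \<le> d"
proof -
  let ?H = "{y \<in> nbrs E v. d < card (nbrs E v \<inter> nbrs E y)}"
  have fin: "finite ?H" "finite (nbrs E x)" for x using finite_nbrs[OF E] by auto
  have "finite (triangle_pairs E E v)"
    by (rule finite_subset[of _ "nbrs E v \<times> nbrs E v"]) (auto simp: triangle_pairs_def fin)
  moreover have "Sigma ?H (\<lambda>y. nbrs E v \<inter> nbrs E y) \<subseteq> triangle_pairs E E v"
    by (auto simp: triangle_pairs_def nbrs_def)
  ultimately have "card (Sigma ?H (\<lambda>y. nbrs E v \<inter> nbrs E y)) \<le> card (triangle_pairs E E v)"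
    by (rule card_mono)
  then have "(\<Sum>y\<in>?H. real (card (nbrs E v \<inter> nbrs E y))) \<le> real (card (triangle_pairs E E v))"
    using fin by (simp flip: of_nat_sum)
  moreover have "(\<Sum>y\<in>?H. d) \<le> (\<Sum>y\<in>?H. real (card (nbrs E v \<inter> nbrs E y)))"
    by (intro sum_mono) auto
  ultimately have "d * card ?H \<le> d * d" using t by (simp add: power2_eq_square mult_ac)
  then show ?thesis using \<open>0 < d\<close> by (simp add: mult_le_cancel_left_pos)
qed

text \<open>At most \<open>2 * d * n\<close> edges are deleted. If \<open>R\<close> or
  \<open>B\<close> is too large, this loss is doubled by balance, which gives
  \<open>16 * d * n\<close> after multiplication by 4. In the remaining case the losses are
  \<open>8 * d * n\<close> from the deletion and \<open>2 * (d + 2) * n\<close> from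
  \<open>three_class_bound\<close>.\<close>

lemma edge_bound_if_almost_structured:
  fixes d :: real
  assumes G: "bicolored_graph G" and bal: "balanced (1 / 2) G" and "0 < d"
    and struct: "almost_structured d G"
  defines "n \<equiv> real (card (verts G))"
  shows "4 * real (card (edges G)) \<le> n\<^sup>2 + 16 * d * n + 4 * n"
proof -
  note E = simple_on_graph[OF G] and Ec = simple_on_colour_class[OF G]
  let ?V = "verts G" and ?E = "edges G" and ?N = "\<lambda>c. nbrs (colour_class G c)"
  from struct obtain X where X: "X \<subseteq> ?V" "card X \<le> d"
    and XV: "\<And>v. v \<in> ?V - X \<Longrightarrow> card (?N Red v) \<le> d \<or> card (?N Blue v) \<le> d \<or>
      card (triangle_pairs ?E ?E v) \<le> d\<^sup>2"
    unfolding almost_structured_def by blast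
  have finV: "finite ?V" using E by (simp add: simple_on_def)
  define R where "R = {v \<in> ?V - X. card (?N Blue v) \<le> d}"
  define B where "B = {v \<in> ?V - X - R. card (?N Red v) \<le> d}"
  define U where "U = ?V - X - R - B"
  \<comment> \<open>Deleting these edges isolates \<open>X\<close>, leaves only red edges at
    \<open>R\<close>, only blue edges at \<open>B\<close>, and only edges of small codegree at
    \<open>U\<close>.\<close>
  define bad where "bad v = (if v \<in> X then nbrs ?E v else if v \<in> R then ?N Blue v else if v \<in> B then ?N Red v
     else if v \<in> U then {y \<in> nbrs ?E v. d < card (nbrs ?E v \<inter> nbrs ?E y)} else {})" for v
  have disj: "R \<inter> B = {}" "R \<inter> U = {}" "B \<inter> U = {}" "X \<inter> (R \<union> B \<union> U) = {}"
    and V: "?V = X \<union> (R \<union> B \<union> U)"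
    using X by (auto simp: R_def B_def U_def)
  have fin: "finite R" "finite B" "finite U" "finite X" using finV V by (metis finite_Un)+
  have bad_eq: "x \<in> R \<Longrightarrow> bad x = ?N Blue x" "x \<in> B \<Longrightarrow> bad x = ?N Red x"
    "x \<in> U \<Longrightarrow> bad x = {y \<in> nbrs ?E x. d < card (nbrs ?E x \<inter> nbrs ?E y)}" for x
    unfolding bad_def by (auto simp: R_def B_def U_def)
  have badN: "bad v \<subseteq> nbrs ?E v" for v
    using nbrs_mono[OF colour_class_subset[of G]] by (auto simp: bad_def)
  have badd: "card (bad v) \<le> d" if "v \<in> ?V - X" for v
  proof -
    have "v \<in> R \<union> B \<union> U" using that V by blast
    then consider "v \<in> R" | "v \<in> B" "v \<notin> R" | "v \<in> U" "v \<notin> R" "v \<notin> B" by blast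
    then show ?thesis
    proof cases
      case 3
      then have "card (triangle_pairs ?E ?E v) \<le> d\<^sup>2"
        using XV[OF that] that by (auto simp: R_def B_def)
      from card_high_codegree_le[OF E \<open>0 < d\<close> this] show ?thesis using 3 that by (simp add: bad_def)
    qed (use that in \<open>auto simp: bad_def R_def B_def\<close>)
  qed
  let ?D = "{e \<in> ?E. \<exists>x\<in>e. \<exists>y\<in>e. y \<in> bad x}"
  have "real (card ?D) \<le> (\<Sum>v\<in>?V. real (card (bad v)))"
    using card_deleted_le[OF E badN] by (simp flip: of_nat_sum)
  also have "\<dots> = (\<Sum>v\<in>X. real (card (bad v))) + (\<Sum>v\<in>?V - X. real (card (bad v)))"
    using sum.subset_diff[OF X(1) finV, of "\<lambda>v. real (card (bad v))"] by simp
  \<comment> \<open>The at most \<open>d\<close> vertices of \<open>X\<close> are charged up to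
    \<open>n\<close> edges each, every other vertex at most \<open>d\<close>.\<close>
  also have "\<dots> \<le> (\<Sum>v\<in>X. n) + (\<Sum>v\<in>?V - X. d)"
  proof (intro add_mono sum_mono)
    fix v show "real (card (bad v)) \<le> n"
      unfolding n_def using badN[of v] nbrs_subset[OF E, of v] finV by (intro of_nat_mono card_mono) auto
  qed (use badd in auto)
  also have "\<dots> = card X * n + card (?V - X) * d" by simp
  also have "\<dots> \<le> d * n + n * d"
    using X finV \<open>0 < d\<close> by (intro add_mono mult_right_mono) (auto simp: n_def intro!: card_mono)
  finally have D: "card ?D \<le> 2 * d * n" by simp
  define K where "K = ?E - ?D"
  have K: "K \<subseteq> ?E" by (auto simp: K_def)
  have notbad: "y \<notin> bad x" if "{x, y} \<in> K" for x y using that by (auto simp: K_def)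
  have K_sub: "e \<subseteq> R \<union> B \<union> U" if e: "e \<in> K" for e
  proof
    fix x assume "x \<in> e"
    then obtain y where y: "e = {x, y}" "x \<in> ?V"
      using simple_on_edgeE[OF E] e K by blast
    then have "y \<in> nbrs ?E x" using e K by (auto simp: nbrs_def)
    then have "x \<notin> X" using notbad[of x y] e y by (auto simp: bad_def)
    then show "x \<in> R \<union> B \<union> U" using y V by blast
  qed
  have simple_K: "simple_on (R \<union> B \<union> U) K"
    using E K_sub K fin by (auto simp: simple_on_def)
  have cK: "card A \<le> card (A \<inter> K) + card ?D" if "A \<subseteq> ?E" for A
  proof -
    have "A \<subseteq> (A \<inter> K) \<union> ?D" using that by (auto simp: K_def)
    then have "card A \<le> card ((A \<inter> K) \<union> ?D)"
      using simple_on_finite[OF E] by (intro card_mono) (auto simp: K_def)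
    then show ?thesis using card_Un_le[of "A \<inter> K" ?D] by linarith
  qed
  have blueR: "{x, y} \<notin> colour_class G Blue \<inter> K" if "x \<in> R" for x y
    using that notbad[of x y] by (auto simp: bad_eq nbrs_def)
  have redB: "{x, y} \<notin> colour_class G Red \<inter> K" if "x \<in> B" for x y
    using that notbad[of x y] by (auto simp: bad_eq nbrs_def)
  have cV: "card R + card B + card U = card (R \<union> B \<union> U)"
    using fin disj by (simp add: card_Un_disjoint Int_Un_distrib2)
  have "card (R \<union> B \<union> U) \<le> card ?V" using V finV by (intro card_mono) auto
  then have le_n: "real (card R + card B + card U) \<le> n" using cV by (simp add: n_def)
  have n0: "0 \<le> n" by (simp add: n_def)
  have dn: "0 \<le> d * n" using n0 \<open>0 < d\<close> by simp
  have clr: "8 * real (card (colour_class G c \<inter> K)) \<le> n\<^sup>2"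
    if c: "simple_on W (colour_class G c \<inter> K)" and W: "2 * real (card W) \<le> n" for c W
  proof -
    have "8 * real (card (colour_class G c \<inter> K)) = 4 * real (2 * card (colour_class G c \<inter> K))" by simp
    also have "\<dots> \<le> 4 * real (card W * card W)"
      using two_card_edges_le[OF c] by (intro mult_left_mono of_nat_mono) auto
    also have "\<dots> = (2 * real (card W))\<^sup>2" by (simp add: power2_eq_square)
    also have "\<dots> \<le> n\<^sup>2" using W by (intro power_mono) auto
    finally show ?thesis .
  qed
  \<comment> \<open>By balance all edges number at most twice one colour class, and the class
    exceeds its part in \<open>K\<close> by at most \<open>2 * d * n\<close>.\<close>
  have bal': "4 * real (card ?E) \<le> n\<^sup>2 + 16 * d * n + 4 * n"
    if c: "8 * real (card (colour_class G c \<inter> K)) \<le> n\<^sup>2" for c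
  proof -
    have "1 / 2 * real (card ?E) \<le> real (card (colour_class G c))"
      using bal by (simp add: balanced_def)
    moreover have "real (card (colour_class G c)) \<le> real (card (colour_class G c \<inter> K)) + real (card ?D)"
      using of_nat_mono[OF cK[OF colour_class_subset[of G c]], where 'a = real] by simp
    ultimately show ?thesis using c D n0 by linarith
  qed
  consider "card R \<le> card B + card U + 1" "card B \<le> card R + card U + 1"
    | "card R + card U + 1 < card B" | "card B + card U + 1 < card R" by linarith
  then show ?thesis
  proof cases
    case 1
    \<comment> \<open>Codegrees are natural numbers, so rounding \<open>d\<close> down loses
      nothing.\<close>
    define C where "C = nat \<lfloor>d\<rfloor>"
    have C: "C \<le> d" using \<open>0 < d\<close> by (simp add: C_def)
    have "low_codegree C U K"
      unfolding low_codegree_def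
    proof (intro ballI allI impI)
      fix x y assume xy: "x \<in> U" "{x, y} \<in> K"
      have "y \<in> nbrs ?E x" using xy K by (auto simp: nbrs_def)
      then have "real (card (nbrs ?E x \<inter> nbrs ?E y)) \<le> d"
        using notbad[OF xy(2)] xy(1) by (auto simp: bad_eq)
      moreover have "card (nbrs K x \<inter> nbrs K y) \<le> card (nbrs ?E x \<inter> nbrs ?E y)"
        using nbrs_mono[OF K] finite_nbrs[OF E] by (intro card_mono) auto
      ultimately show "card (nbrs K x \<inter> nbrs K y) \<le> C"
        unfolding C_def by (simp add: le_nat_floor)
    qed
    moreover have "{x, y} \<notin> K" if "x \<in> B" "y \<in> R" for x y
    proof
      assume xy: "{x, y} \<in> K"
      then have "{x, y} \<in> colour_class G Red \<union> colour_class G Blue" using K edges_eq_classes[of G] by blast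
      then show False using redB[OF that(1), of y] blueR[OF that(2), of x] xy by (auto simp: insert_commute)
    qed
    ultimately have "4 * card K \<le> (card R + card B + card U)\<^sup>2 + 2 * (C + 2) * (card R + card B + card U)"
      using simple_K disj 1 by (intro three_class_bound) auto
    from of_nat_mono[OF this, where 'a = real]
    have "4 * real (card K) \<le> (real (card R + card B + card U))\<^sup>2 + 2 * (real C + 2) * real (card R + card B + card U)"
      by (simp add: algebra_simps)
    also have "\<dots> \<le> n\<^sup>2 + 2 * (d + 2) * n"
      using le_n C by (intro add_mono power_mono mult_mono) auto
    finally have "4 * real (card K) \<le> n\<^sup>2 + 2 * (d * n) + 4 * n" by (simp add: algebra_simps)
    moreover have "real (card ?E) \<le> real (card K) + real (card ?D)"
      using of_nat_mono[OF cK[OF subset_refl], where 'a = real] K by (simp add: Int_absorb1)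
    ultimately show ?thesis using D dn by linarith
  next
    \<comment> \<open>All red edges of \<open>K\<close> lie in \<open>R \<union> U\<close>, which is
      smaller than \<open>B\<close> and hence has at most \<open>n / 2\<close> vertices. The last
      case exchanges the colours.\<close>
    case 2
    have "simple_on (R \<union> U) (colour_class G Red \<inter> K)"
      unfolding simple_on_def
    proof (intro conjI ballI)
      fix e assume e: "e \<in> colour_class G Red \<inter> K"
      have "x \<notin> B" if "x \<in> e" for x
        using simple_on_edgeE[OF simple_K _ that] e redB[of x] by blast
      then show "e \<subseteq> R \<union> U" using K_sub[of e] e by auto
      show "card e = 2" using simple_K e by (auto simp: simple_on_def)
    qed (use fin in auto)
    moreover have "2 * real (card (R \<union> U)) \<le> n"
      using 2 le_n card_Un_le[of R U] by linarith
    ultimately show ?thesis by (intro bal'[of Red] clr)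
  next
    case 3
    have "simple_on (B \<union> U) (colour_class G Blue \<inter> K)"
      unfolding simple_on_def
    proof (intro conjI ballI)
      fix e assume e: "e \<in> colour_class G Blue \<inter> K"
      have "x \<notin> R" if "x \<in> e" for x
        using simple_on_edgeE[OF simple_K _ that] e blueR[of x] by blast
      then show "e \<subseteq> B \<union> U" using K_sub[of e] e by auto
      show "card e = 2" using simple_K e by (auto simp: simple_on_def)
    qed (use fin in auto)
    moreover have "2 * real (card (B \<union> U)) \<le> n"
      using 3 le_n card_Un_le[of B U] by linarith
    ultimately show ?thesis by (intro bal'[of Blue] clr)
  qed
qed

section \<open>Extremal graphs and the construction from two cliques\<close>

lemma ex_number_attained:
  assumes "{card (edges G) | G :: nat bgraph. bicolored_graph G \<and> card (verts G) = n \<and> balanced \<epsilon> G \<and>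
            (\<forall>F\<in>\<F>. \<not> contains G F)} \<noteq> {}"
  obtains G :: "nat bgraph" where "bicolored_graph G" "card (verts G) = n" "balanced \<epsilon> G"
    "\<forall>F\<in>\<F>. \<not> contains G F" "ex_number \<epsilon> n \<F> = card (edges G)"
  using Max_in[OF finite_ex_candidates assms] that unfolding ex_number_def by blast

lemma card_edges_le_ex_number:
  fixes G :: "nat bgraph"
  assumes "bicolored_graph G" "card (verts G) = n" "balanced \<epsilon> G" "\<forall>F\<in>\<F>. \<not> contains G F"
  shows "card (edges G) \<le> ex_number \<epsilon> n \<F>"
  unfolding ex_number_def using assms by (intro Max_ge finite_ex_candidates) auto

text \<open>Balance with constant 1/2 forces colour classes of equal size, so both cliques have
  \<open>n div 2\<close> vertices, and for odd \<open>n\<close> one vertex stays isolated.\<close>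

definition two_cliques :: "nat \<Rightarrow> nat bgraph" where
  "two_cliques n = \<lparr>verts = {..<n},
     edges = {e. e \<subseteq> {..<n div 2} \<and> card e = 2} \<union> {e. e \<subseteq> {n div 2..<2 * (n div 2)} \<and> card e = 2},
     colour_of = (\<lambda>e. if e \<subseteq> {..<n div 2} then Red else Blue)\<rparr>"

lemma colour_class_two_cliques:
  "colour_class (two_cliques n) Red = {e. e \<subseteq> {..<n div 2} \<and> card e = 2}"
  "colour_class (two_cliques n) Blue = {e. e \<subseteq> {n div 2..<2 * (n div 2)} \<and> card e = 2}"
proof -
  have "\<not> e \<subseteq> {..<n div 2}" if "e \<subseteq> {n div 2..<2 * (n div 2)}" "card e = 2" for e
  proof
    assume "e \<subseteq> {..<n div 2}"
    then have "e = {}" using that(1) by fastforce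
    then show False using that(2) by simp
  qed
  then show "colour_class (two_cliques n) Red = {e. e \<subseteq> {..<n div 2} \<and> card e = 2}"
    "colour_class (two_cliques n) Blue = {e. e \<subseteq> {n div 2..<2 * (n div 2)} \<and> card e = 2}"
    by (auto simp: colour_class_def two_cliques_def)
qed

lemma card_colour_class_two_cliques: "card (colour_class (two_cliques n) c) = (n div 2) choose 2"
  by (cases c) (simp_all add: colour_class_two_cliques n_subsets)

lemma card_edges_two_cliques: "card (edges (two_cliques n)) = 2 * ((n div 2) choose 2)"
proof -
  have "finite (colour_class (two_cliques n) c)" for c
    by (cases c) (simp_all add: colour_class_two_cliques)
  moreover have "colour_class (two_cliques n) Red \<inter> colour_class (two_cliques n) Blue = {}"
    by (auto simp: colour_class_def)
  ultimately have "card (edges (two_cliques n)) =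
      card (colour_class (two_cliques n) Red) + card (colour_class (two_cliques n) Blue)"
    by (subst edges_eq_classes) (intro card_Un_disjoint; simp)
  then show ?thesis by (simp add: card_colour_class_two_cliques)
qed

lemma two_cliques_candidate:
  "bicolored_graph (two_cliques n)" "card (verts (two_cliques n)) = n" "balanced (1 / 2) (two_cliques n)"
proof -
  show "bicolored_graph (two_cliques n)"
    unfolding bicolored_graph_def by (auto simp: two_cliques_def subset_iff)
  show "card (verts (two_cliques n)) = n" by (simp add: two_cliques_def)
  show "balanced (1 / 2) (two_cliques n)"
    by (simp add: balanced_def card_colour_class_two_cliques card_edges_two_cliques)
qed

text \<open>Adjacent vertices lie in the same clique, so the image of a cycle stays in one clique
  and sees only its colour.\<close>

lemma two_cliques_free:
  assumes "F \<in> non_mono_cycles k"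
  shows "\<not> contains (two_cliques n) F"
proof
  assume "contains (two_cliques n) F"
  then obtain f where f: "\<And>e. e \<in> edges F \<Longrightarrow> f ` e \<in> edges (two_cliques n) \<and> colour_of (two_cliques n) (f ` e) = colour_of F e"
    unfolding contains_def by blast
  obtain v where e: "edges F = {{v i, v (Suc i mod k)} | i. i < k}"
    using assms by (auto simp: non_mono_cycles_def is_cycle_def)
  define s where "s i = (if f (v i) < n div 2 then Red else Blue)" for i
  have s: "colour_of F {v i, v (Suc i mod k)} = s i" "s (Suc i mod k) = s i" if "i < k" for i
  proof -
    have "{v i, v (Suc i mod k)} \<in> edges F" using e that by blast
    from f[OF this] show "colour_of F {v i, v (Suc i mod k)} = s i" "s (Suc i mod k) = s i"
      by (auto simp: two_cliques_def s_def)
  qed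
  have "s i = s 0" if "i < k" for i
    using that
  proof (induction i)
    case (Suc i)
    then show ?case using s(2)[of i] by simp
  qed simp
  note s0 = this
  have "colour_of F e = s 0" if "e \<in> edges F" for e
  proof -
    from that obtain i where "e = {v i, v (Suc i mod k)}" "i < k" unfolding e by blast
    then show ?thesis using s(1)[of i] s0[of i] by metis
  qed
  moreover have "colour_class F Red \<noteq> {}" "colour_class F Blue \<noteq> {}"
    using assms by (auto simp: non_mono_cycles_def non_monochromatic_def)
  ultimately show False by (auto simp: colour_class_def)
qed

section \<open>Lower bound, upper bound and the limit\<close>

lemma real_choose_two: "real (m choose 2) = real m * (real m - 1) / 2"
  by (induction m) (simp_all add: numeral_2_eq_2 field_simps)

text \<open>With \<open>m = n div 2\<close> the two cliques have \<open>m * (m - 1)\<close> edges,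
  and \<open>2 * m \<ge> n - 1\<close>. For \<open>n \<le> 3\<close> the left-hand side is not
  positive.\<close>

lemma ex_number_half_lower:
  "real (n - 1) * (real n - 3) \<le> 4 * real (ex_number (1 / 2) n (non_mono_cycles k))"
proof -
  define m where "m = n div 2"
  have "2 * (m choose 2) \<le> ex_number (1 / 2) n (non_mono_cycles k)"
    using card_edges_le_ex_number[OF two_cliques_candidate, of "non_mono_cycles k" n] two_cliques_free
    by (simp add: card_edges_two_cliques m_def)
  then have "real (2 * (m choose 2)) \<le> real (ex_number (1 / 2) n (non_mono_cycles k))"
    by (rule of_nat_mono)
  then have "real m * (real m - 1) \<le> real (ex_number (1 / 2) n (non_mono_cycles k))"
    by (simp add: real_choose_two)
  moreover have "real (n - 1) * (real n - 3) \<le> 4 * (real m * (real m - 1))"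
  proof (cases "n \<le> 3")
    case True
    then have "real (n - 1) * (real n - 3) \<le> 0" by (intro mult_nonneg_nonpos) auto
    moreover have "0 \<le> real m * (real m - 1)" by (cases m) auto
    ultimately show ?thesis by linarith
  next
    case False
    have "n \<le> 2 * m + 1" by (simp add: m_def)
    then have "real n \<le> 2 * real m + 1" by linarith
    moreover have "3 < real n" using False by simp
    ultimately have "real (n - 1) \<le> 2 * real m" "real n - 3 \<le> 2 * (real m - 1)" "0 \<le> real n - 3"
      by auto
    then have "real (n - 1) * (real n - 3) \<le> (2 * real m) * (2 * (real m - 1))"
      by (intro mult_mono) auto
    then show ?thesis by (simp add: algebra_simps)
  qed
  ultimately show ?thesis by linarith
qed

text \<open>An extremal graph is almost structured with \<open>d = \<eta> * n\<close> for large
  \<open>n\<close>, which turns the error \<open>16 * d * n\<close> into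
  \<open>16 * \<eta> * n\<^sup>2\<close>.\<close>

lemma ex_number_half_upper:
  fixes \<eta> :: real
  assumes "4 \<le> k" "0 < \<eta>" "\<eta> \<le> 1"
  shows "\<forall>\<^sub>F n in sequentially. 4 * real (ex_number (1 / 2) n (non_mono_cycles k))
     \<le> (1 + 16 * \<eta>) * (real n)\<^sup>2 + 4 * real n"
  using almost_structured_if_free[OF assms] eventually_gt_at_top[of 0]
proof eventually_elim
  case (elim n)
  \<comment> \<open>The two cliques are a candidate, so the maximum is attained by some
    graph.\<close>
  have "{card (edges G) | G :: nat bgraph. bicolored_graph G \<and> card (verts G) = n \<and> balanced (1 / 2) G \<and>
            (\<forall>F\<in>non_mono_cycles k. \<not> contains G F)} \<noteq> {}"
    using two_cliques_candidate[of n] two_cliques_free by blast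
  then obtain G :: "nat bgraph" where G: "bicolored_graph G" "card (verts G) = n" "balanced (1 / 2) G"
    "\<forall>F\<in>non_mono_cycles k. \<not> contains G F" "ex_number (1 / 2) n (non_mono_cycles k) = card (edges G)"
    by (rule ex_number_attained)
  have "4 * real (card (edges G)) \<le> (real n)\<^sup>2 + 16 * (\<eta> * real n) * real n + 4 * real n"
    using edge_bound_if_almost_structured[OF G(1,3), of "\<eta> * real n"] elim G assms by auto
  then show ?case unfolding G(5) by (simp add: power2_eq_square algebra_simps)
qed

lemma ex_ratio_half_tendsto:
  assumes "4 \<le> k"
  shows "ex_ratio (1 / 2) (non_mono_cycles k) \<longlonglongrightarrow> 1 / 2"
proof -
  let ?x = "\<lambda>n. real (ex_number (1 / 2) n (non_mono_cycles k))"
  have ratio: "ex_ratio (1 / 2) (non_mono_cycles k) n = 4 * ?x n / (2 * (real n * (real n - 1)))" for n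
    by (simp add: ex_ratio_def real_choose_two)
  show ?thesis
  proof (rule order_tendstoI)
    fix a :: real assume "a < 1 / 2"
    \<comment> \<open>This is the lower bound divided by \<open>n choose 2\<close>, with the factor
      \<open>n - 1\<close> cancelled.\<close>
    have "(\<lambda>n. (real n - 3) / (2 * real n)) \<longlonglongrightarrow> 1 / 2" by real_asymp
    then have "\<forall>\<^sub>F n in sequentially. a < (real n - 3) / (2 * real n)"
      using \<open>a < 1 / 2\<close> by (rule order_tendstoD)
    then show "\<forall>\<^sub>F n in sequentially. a < ex_ratio (1 / 2) (non_mono_cycles k) n"
      using eventually_gt_at_top[of 1]
    proof eventually_elim
      case (elim n)
      then have "(real n - 3) / (2 * real n) = real (n - 1) * (real n - 3) / (2 * (real n * (real n - 1)))"
        by (simp add: of_nat_diff)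
      also have "\<dots> \<le> 4 * ?x n / (2 * (real n * (real n - 1)))"
        using elim by (intro divide_right_mono ex_number_half_lower) auto
      finally show ?case using elim ratio by simp
    qed
  next
    fix a :: real assume "1 / 2 < a"
    \<comment> \<open>Chosen so that \<open>(1 + 16 * \<eta>) / 2\<close> is at most the midpoint
      between \<open>1 / 2\<close> and \<open>a\<close>.\<close>
    define \<eta> where "\<eta> = min 1 ((a - 1 / 2) / 16)"
    have \<eta>: "0 < \<eta>" "\<eta> \<le> 1" "(1 + 16 * \<eta>) / 2 < a" using \<open>1 / 2 < a\<close> by (auto simp: \<eta>_def min_def field_simps)
    have "(\<lambda>n. ((1 + 16 * \<eta>) * (real n)\<^sup>2 + 4 * real n) / (2 * (real n * (real n - 1)))) \<longlonglongrightarrow> (1 + 16 * \<eta>) / 2"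
      using \<eta> by real_asymp
    then have "\<forall>\<^sub>F n in sequentially. ((1 + 16 * \<eta>) * (real n)\<^sup>2 + 4 * real n) / (2 * (real n * (real n - 1))) < a"
      using \<eta>(3) by (rule order_tendstoD)
    then show "\<forall>\<^sub>F n in sequentially. ex_ratio (1 / 2) (non_mono_cycles k) n < a"
      using eventually_gt_at_top[of 1] ex_number_half_upper[OF assms \<eta>(1,2)]
    proof eventually_elim
      case (elim n)
      then have "4 * ?x n / (2 * (real n * (real n - 1)))
          \<le> ((1 + 16 * \<eta>) * (real n)\<^sup>2 + 4 * real n) / (2 * (real n * (real n - 1)))"
        by (intro divide_right_mono) auto
      with elim ratio show ?case by simp
    qed
  qed
qed

theorem theorem1p5:
  fixes k :: nat
  assumes "k \<ge> 4"
  shows "convergent (ex_ratio (1/2) (non_mono_cycles k)) \<and>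
         ex_density (1/2) (non_mono_cycles k) = 1/2"
  using ex_ratio_half_tendsto[OF assms]
  by (auto simp: ex_density_def convergent_def limI)

end
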